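(* Let $(X,d)$ be a metric space and $T:X\to\mathcal{CB}(X)$. Suppose there exist a metric-preserving function $f:[0,\infty)\to[0,\infty)$ and $k\in(0,1)$ such that for all $x,y\in X$, $f(H(Tx,Ty))\le k\,d(x,y)$, and such that at least one of the following holds: (b) $f'(0)>k$; or (b$'$) there exists $c\in(0,1)$ such that $kt\le f(ct)$ for all $t>0$ sufficiently small. Then, for $\varepsilon>0$ sufficiently small: if in addition $X$ is complete and $\varepsilon$-chainable, then $T$ has a fixed point. In particular, if $X$ is complete and connected, then $T$ has a fixed point.
   Context: A function $f:[0,\infty)\to[0,\infty)$ is metric-preserving if for every metric space $(Y,\rho)$, the composition $f\circ\rho$ is a metric on $Y$. For a metric-preserving $f$, $f'(0)$ denotes the one-sided derivative $\lim_{y\to0^+}\frac{f(y)-f(0)}{y}=\lim_{y\to0^+}\frac{f(y)}{y}$ (note $f(0)=0$); it is a known fact that this limit always exists in $\mathbb R\cup\{+\infty\}$, and the value $+\infty$ is allowed. $\mathcal{CB}(X)$ is the family of nonempty, closed and bounded subsets of $X$, with Hausdorff distance $H(A,B)=\max\{\sup_{x\in A}d(x,B),\sup_{x\in B}d(x,A)\}$, where $d(x,B)=\inf_{y\in B}d(x,y)$. A fixed point of $T$ is a point $x\in X$ with $x\in Tx$. For $\varepsilon>0$, $(X,d)$ is $\varepsilon$-chainable if for all $a,b\in X$ there exist $x_1,\dots,x_n\in X$ with $x_1=a$, $x_n=b$ and $d(x_i,x_{i+1})<\varepsilon$ for all $1\le i\le n-1$. *)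

theory Defs
  imports "HOL-Analysis.Analysis"
begin

text \<open>
  HOL cannot quantify over types inside a formula, so the metric spaces \<open>Y\<close> below range over
  carrier sets of reals.  This loses nothing: the lemma \<open>metric_preserving_iff\<close> gives the
  same condition for carriers in any type with at least three elements, and
  \<open>metric_preserving_compose\<close> gives preservation for carriers in every type.
  Only the values of \<open>f\<close> on \<open>{0..}\<close> matter.
\<close>

definition metric_preserving :: "(real \<Rightarrow> real) \<Rightarrow> bool" where
  "metric_preserving f \<longleftrightarrow>
     f \<in> {0..} \<rightarrow> {0..} \<and>
     (\<forall>(Y :: real set) \<rho>. Metric_space Y \<rho> \<longrightarrow> Metric_space Y (\<lambda>x y. f (\<rho> x y)))"

lemma metric_preserving_transfer:
  fixes f :: "real \<Rightarrow> real" and Y :: "'a set"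
  assumes range: "f \<in> {0..} \<rightarrow> {0..}"
    and pres: "\<And>(Z :: 'b set) \<sigma>. Metric_space Z \<sigma> \<Longrightarrow> Metric_space Z (\<lambda>x y. f (\<sigma> x y))"
    and big: "\<And>S :: 'a set. finite S \<Longrightarrow> card S \<le> 3 \<Longrightarrow> \<exists>g :: 'a \<Rightarrow> 'b. inj_on g S"
    and Y: "Metric_space Y \<rho>"
  shows "Metric_space Y (\<lambda>x y. f (\<rho> x y))"
proof -
  interpret Metric_space Y \<rho> by (rule Y)
  have copy: "(f (\<rho> x y) = 0 \<longleftrightarrow> x = y) \<and> f (\<rho> x z) \<le> f (\<rho> x y) + f (\<rho> y z)"
    if xyz: "x \<in> Y" "y \<in> Y" "z \<in> Y" for x y z
  proof -
    define S where "S = {x, y, z}"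
    have "card S \<le> 3"
      unfolding S_def by (simp add: card_insert_if)
    then obtain g :: "'a \<Rightarrow> 'b" where g: "inj_on g S"
      using big[of S] by (metis S_def finite.emptyI finite_insert)
    define h where "h = inv_into S g"
    have h: "h (g u) = u" if "u \<in> S" for u
      using g that by (simp add: h_def)
    have S: "x \<in> S" "y \<in> S" "z \<in> S" "S \<subseteq> Y"
      using xyz by (auto simp: S_def)
    have hY: "h a \<in> Y" if "a \<in> g ` S" for a
      using that h S(4) by (metis imageE subsetD)
    have "Metric_space (g ` S) (\<lambda>a b. \<rho> (h a) (h b))"
    proof
      show "\<rho> (h a) (h b) = 0 \<longleftrightarrow> a = b" if "a \<in> g ` S" "b \<in> g ` S" for a b
      proof -
        have "h a = h b \<longleftrightarrow> a = b"
          using that h by (metis imageE)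
        then show ?thesis
          using zero[OF hY hY] that by blast
      qed
      show "\<rho> (h a) (h c) \<le> \<rho> (h a) (h b) + \<rho> (h b) (h c)"
        if "a \<in> g ` S" "b \<in> g ` S" "c \<in> g ` S" for a b c
        by (rule triangle[OF hY[OF that(1)] hY[OF that(2)] hY[OF that(3)]])
    qed (rule nonneg commute)+
    from pres[OF this] interpret C: Metric_space "g ` S" "\<lambda>a b. f (\<rho> (h a) (h b))" .
    have "f (\<rho> (h (g x)) (h (g y))) = 0 \<longleftrightarrow> g x = g y"
      by (rule C.zero[OF imageI[OF S(1)] imageI[OF S(2)]])
    moreover have "f (\<rho> (h (g x)) (h (g z)))
        \<le> f (\<rho> (h (g x)) (h (g y))) + f (\<rho> (h (g y)) (h (g z)))"
      by (rule C.triangle[OF imageI[OF S(1)] imageI[OF S(2)] imageI[OF S(3)]])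
    moreover have "g x = g y \<longleftrightarrow> x = y"
      by (rule inj_on_eq_iff[OF g S(1,2)])
    ultimately show ?thesis
      by (simp only: h[OF S(1)] h[OF S(2)] h[OF S(3)])
  qed
  show ?thesis
  proof
    show "0 \<le> f (\<rho> x y)" for x y
      using range by (simp add: Pi_iff)
    show "f (\<rho> x y) = f (\<rho> y x)" for x y
      by (simp only: commute[of x y])
    show "f (\<rho> x y) = 0 \<longleftrightarrow> x = y" if "x \<in> Y" "y \<in> Y" for x y
      using copy[OF that that(1)] by (rule conjunct1)
    show "f (\<rho> x z) \<le> f (\<rho> x y) + f (\<rho> y z)" if "x \<in> Y" "y \<in> Y" "z \<in> Y" for x y z
      using copy[OF that] by (rule conjunct2)
  qed
qed

lemma inj_on_of_card_le:
  fixes S :: "'a set" and B :: "'b set"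
  assumes "finite S" "card S \<le> n" "finite B" "n \<le> card B"
  shows "\<exists>g :: 'a \<Rightarrow> 'b. inj_on g S"
proof -
  obtain g where "g ` S \<subseteq> B" "inj_on g S"
    using card_le_inj[OF assms(1,3) order_trans[OF assms(2,4)]] by blast
  then show ?thesis by blast
qed

lemma metric_preserving_compose:
  fixes Y :: "'a set"
  assumes f: "metric_preserving f" and Y: "Metric_space Y \<rho>"
  shows "Metric_space Y (\<lambda>x y. f (\<rho> x y))"
proof -
  have big: "\<exists>g :: 'a \<Rightarrow> real. inj_on g S" if "finite S" "card S \<le> 3" for S :: "'a set"
    by (rule inj_on_of_card_le[OF that, where B = "{0, 1, 2 :: real}"]) simp_all
  have range: "f \<in> {0..} \<rightarrow> {0..}"
    using f unfolding metric_preserving_def by (rule conjunct1)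
  have pres: "Metric_space Z (\<lambda>x y. f (\<sigma> x y))" if "Metric_space Z \<sigma>" for Z :: "real set" and \<sigma>
    by (rule f[unfolded metric_preserving_def, THEN conjunct2, rule_format, OF that])
  show ?thesis
    by (rule metric_preserving_transfer[where f = f and \<rho> = \<rho>, OF range pres big Y])
qed

lemma metric_preserving_iff:
  assumes B: "finite (B :: 'b set)" "3 \<le> card B"
  shows "metric_preserving f \<longleftrightarrow>
     f \<in> {0..} \<rightarrow> {0..} \<and>
     (\<forall>(Y :: 'b set) \<rho>. Metric_space Y \<rho> \<longrightarrow> Metric_space Y (\<lambda>x y. f (\<rho> x y)))"
    (is "?L \<longleftrightarrow> ?R")
proof
  assume L: ?L
  have range: "f \<in> {0..} \<rightarrow> {0..}"
    using L unfolding metric_preserving_def by (rule conjunct1)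
  show ?R
    by (intro conjI range allI impI) (rule metric_preserving_compose[OF L])
next
  assume R: ?R
  have big: "\<exists>g :: real \<Rightarrow> 'b. inj_on g S" if "finite S" "card S \<le> 3" for S :: "real set"
    by (rule inj_on_of_card_le[OF that B])
  have range: "f \<in> {0..} \<rightarrow> {0..}"
    using R by (rule conjunct1)
  have pres: "Metric_space Z (\<lambda>x y. f (\<sigma> x y))" if "Metric_space Z \<sigma>" for Z :: "'b set" and \<sigma>
    by (rule R[THEN conjunct2, rule_format, OF that])
  show ?L
    unfolding metric_preserving_def
    by (intro conjI range allI impI) (rule metric_preserving_transfer[where f = f, OF range pres big])
qed

text \<open>The one-sided derivative at \<open>0\<close>, with \<open>\<infinity>\<close> allowed as a value.\<close>

definition has_right_deriv_0 :: "(real \<Rightarrow> real) \<Rightarrow> ereal \<Rightarrow> bool" where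
  "has_right_deriv_0 f L \<longleftrightarrow> ((\<lambda>y. ereal ((f y - f 0) / y)) \<longlongrightarrow> L) (at_right 0)"

definition CB :: "'a set \<Rightarrow> ('a \<Rightarrow> 'a \<Rightarrow> real) \<Rightarrow> 'a set set" where
  "CB X d = {A. A \<noteq> {} \<and> closedin (Metric_space.mtopology X d) A \<and> Metric_space.mbounded X d A}"

text \<open>Infima and suprema are real-valued, hence meaningful only for nonempty bounded sets.\<close>

definition point_set_dist :: "('a \<Rightarrow> 'a \<Rightarrow> real) \<Rightarrow> 'a \<Rightarrow> 'a set \<Rightarrow> real" where
  "point_set_dist d x B = (INF y\<in>B. d x y)"

definition hausdorff_distance :: "('a \<Rightarrow> 'a \<Rightarrow> real) \<Rightarrow> 'a set \<Rightarrow> 'a set \<Rightarrow> real" where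
  "hausdorff_distance d A B =
     max (SUP x\<in>A. point_set_dist d x B) (SUP x\<in>B. point_set_dist d x A)"

definition chainable :: "'a set \<Rightarrow> ('a \<Rightarrow> 'a \<Rightarrow> real) \<Rightarrow> real \<Rightarrow> bool" where
  "chainable X d \<epsilon> \<longleftrightarrow>
     (\<forall>a\<in>X. \<forall>b\<in>X. \<exists>n\<ge>1. \<exists>x :: nat \<Rightarrow> 'a.
        (\<forall>i\<in>{1..n}. x i \<in> X) \<and> x 1 = a \<and> x n = b \<and>
        (\<forall>i. 1 \<le> i \<and> i \<le> n - 1 \<longrightarrow> d (x i) (x (i + 1)) < \<epsilon>))"

end

theory Submission
  imports Defs
begin

text \<open>
  For small \<open>h\<close> the hypothesis gives \<open>(k/c) h \<le> f h\<close>, and a value \<open>f h\<close> near \<open>0\<close> forces \<open>h\<close> to be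
  small.  Applied to \<open>h = H (T x) (T y)\<close>, this turns \<open>f h \<le> k d x y\<close> into \<open>h \<le> c d x y\<close> whenever
  \<open>d x y\<close> is below some \<open>\<epsilon>\<^sub>0\<close> that depends only on \<open>f\<close>, \<open>k\<close> and \<open>c\<close>.  Nadler's argument
  then applies: an \<open>\<epsilon>\<close>-chain from \<open>x\<^sub>0\<close> to a point of \<open>T x\<^sub>0\<close> is lifted link by link through \<open>T\<close>, each
  time shrinking all links by a factor \<open>q < 1\<close>, and the initial points of the successive chains
  converge to a fixed point.
\<close>

subsection \<open>Metric-preserving functions\<close>

text \<open>Three points with distances \<open>b\<close>, \<open>b\<close>, \<open>a\<close> form a
  metric space because \<open>a \<le> 2 * b\<close>; the conclusions are read off from the metric
  axioms of its image under \<open>f\<close>.\<close>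

lemma metric_preserving_isosceles:
  assumes f: "metric_preserving f" and a: "0 < a" "a \<le> 2 * b"
  shows "f 0 = 0" "0 < f b" "f a \<le> 2 * f b"
proof -
  define \<rho> :: "real \<Rightarrow> real \<Rightarrow> real" where
    "\<rho> x y = (if x = y then 0 else if {x, y} = {0, 2} then a else b)" for x y
  have "Metric_space {0, 1, 2} \<rho>"
    by unfold_locales (use a in \<open>auto simp: \<rho>_def doubleton_eq_iff\<close>)
  then interpret M: Metric_space "{0, 1, 2}" "\<lambda>x y. f (\<rho> x y)"
    by (rule metric_preserving_compose[OF f])
  have \<rho>: "\<rho> 0 0 = 0" "\<rho> 0 1 = b" "\<rho> 1 2 = b" "\<rho> 0 2 = a"
    by (auto simp: \<rho>_def doubleton_eq_iff)
  show "f 0 = 0"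
    using M.zero[of 0 0] by (simp add: \<rho>)
  show "0 < f b"
    using M.zero[of 0 1] M.nonneg[of 0 1] by (simp add: \<rho>)
  show "f a \<le> 2 * f b"
    using M.triangle[of 0 1 2] by (simp add: \<rho>)
qed

text \<open>A real \<open>r\<close> strictly between \<open>k\<close> and \<open>L\<close> exists
  even for infinite \<open>L\<close>, and \<open>f y > r * y\<close> for small \<open>y > 0\<close>.
  Taking \<open>y = k / r * t\<close> shows that \<open>c = k / r\<close> works.\<close>

lemma right_deriv_gt_imp_eventually_le:
  assumes f0: "f 0 = 0" and L: "has_right_deriv_0 f L" "ereal k < L" and k: "0 < k"
  shows "\<exists>c. 0 < c \<and> c < 1 \<and> (\<forall>\<^sub>F t in at_right 0. k * t \<le> f (c * t))"
proof -
  obtain r where r: "ereal k < ereal r" "ereal r < L"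
    using ereal_dense2[OF L(2)] by blast
  have "\<forall>\<^sub>F y in at_right 0. ereal r < ereal ((f y - f 0) / y)"
    using order_tendstoD(1)[OF L(1)[unfolded has_right_deriv_0_def] r(2)] .
  then obtain \<delta> where \<delta>: "0 < \<delta>" "\<And>y. 0 < y \<Longrightarrow> y < \<delta> \<Longrightarrow> r < f y / y"
    unfolding eventually_at_right_field by (auto simp: f0)
  have r0: "0 < r" "k < r"
    using r k by simp_all
  have "k * t \<le> f (k / r * t)" if t: "0 < t" "t < \<delta>" for t
  proof -
    have "k / r * t \<le> t"
      using r0 t by (simp add: field_simps)
    then have "r < f (k / r * t) / (k / r * t)"
      by (intro \<delta>(2)) (use r0 t k in auto)
    then have "r * (k / r * t) < f (k / r * t)"
      using r0 t k by (subst (asm) less_divide_eq) simp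
    then show ?thesis
      using r0 by simp
  qed
  then have "\<forall>\<^sub>F t in at_right 0. k * t \<le> f (k / r * t)"
    unfolding eventually_at_right_field using \<delta>(1) by blast
  moreover have "0 < k / r" "k / r < 1"
    using r0 k by simp_all
  ultimately show ?thesis by blast
qed

text \<open>\<open>f\<close> need not be monotone, so a small value \<open>f h\<close> does not
  bound \<open>h\<close> at once. If \<open>h \<ge> \<eta>\<close>, the isosceles triangle gives
  \<open>f \<eta> \<le> 2 * f h\<close>, which the threshold \<open>f \<eta> / (2 * k)\<close> on
  \<open>t\<close> rules out. For \<open>0 < h < \<eta>\<close> the hypothesis is applied at
  \<open>h / c\<close>.\<close>

lemma metric_preserving_le_imp_le:
  assumes f: "metric_preserving f" and k: "0 < k" and c: "0 < c"
    and ev: "\<forall>\<^sub>F t in at_right 0. k * t \<le> f (c * t)"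
  shows "\<exists>\<epsilon>>0. \<forall>h\<ge>0. \<forall>t. 0 < t \<and> t < \<epsilon> \<and> f h \<le> k * t \<longrightarrow> h \<le> c * t"
proof -
  obtain \<delta> where \<delta>: "0 < \<delta>" "\<And>t. 0 < t \<Longrightarrow> t < \<delta> \<Longrightarrow> k * t \<le> f (c * t)"
    using ev unfolding eventually_at_right_field by auto
  define \<eta> where "\<eta> = c * \<delta>"
  have \<eta>: "0 < \<eta>"
    using c \<delta>(1) by (simp add: \<eta>_def)
  show ?thesis
  proof (intro exI[of _ "f \<eta> / (2 * k)"] conjI allI impI)
    show "0 < f \<eta> / (2 * k)"
      using metric_preserving_isosceles(2)[OF f \<eta>, of \<eta>] \<eta> k by simp
    fix h t :: real
    assume h: "0 \<le> h" and t: "0 < t \<and> t < f \<eta> / (2 * k) \<and> f h \<le> k * t"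
    show "h \<le> c * t"
    proof (cases "h = 0")
      case True
      then show ?thesis using c t by simp
    next
      case False
      have "h < \<eta>"
      proof (rule ccontr)
        assume "\<not> h < \<eta>"
        then have "f \<eta> \<le> 2 * f h"
          using metric_preserving_isosceles(3)[OF f \<eta>, of h] \<eta> by simp
        moreover have "2 * (k * t) < f \<eta>"
          using t k by (simp add: field_simps)
        ultimately show False using t by linarith
      qed
      then have "k * (h / c) \<le> f (c * (h / c))"
        using False h c by (intro \<delta>(2)) (auto simp: \<eta>_def field_simps)
      also have "\<dots> \<le> k * t"
        using c t by simp
      finally have "h / c \<le> t"
        by (rule mult_left_le_imp_le[OF _ k])
      then show ?thesis
        using c by (simp add: field_simps)
    qed
  qed
qed

subsection \<open>Hausdorff distance\<close>

context Metric_space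
begin

lemma point_set_dist_nonneg:
  assumes "B \<noteq> {}" shows "0 \<le> point_set_dist d x B"
  unfolding point_set_dist_def using assms by (intro cINF_greatest) auto

lemma point_set_dist_le:
  assumes "b \<in> B" shows "point_set_dist d x B \<le> d x b"
  unfolding point_set_dist_def using assms by (intro cINF_lower bdd_belowI2[of _ 0]) auto

text \<open>Boundedness of \<open>A \<union> B\<close> bounds the distances to \<open>B\<close> from
  above, so that the real-valued supremum is an upper bound.\<close>

lemma point_set_dist_le_hausdorff_distance:
  assumes A: "mbounded A" and B: "mbounded B" "B \<noteq> {}" and a: "a \<in> A"
  shows "point_set_dist d a B \<le> hausdorff_distance d A B"
proof -
  obtain b where b: "b \<in> B"
    using B(2) by blast
  have "mbounded (A \<union> B)"
    using A B by (simp add: mbounded_Un)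
  then obtain K where K: "\<And>x y. x \<in> A \<union> B \<Longrightarrow> y \<in> A \<union> B \<Longrightarrow> d x y \<le> K"
    unfolding mbounded_alt by blast
  have "point_set_dist d x B \<le> K" if "x \<in> A" for x
    using point_set_dist_le[OF b, of x] K[of x b] that b by auto
  then have "bdd_above ((\<lambda>x. point_set_dist d x B) ` A)"
    by (intro bdd_aboveI2)
  then have "point_set_dist d a B \<le> (SUP x\<in>A. point_set_dist d x B)"
    using a by (intro cSUP_upper)
  then show ?thesis
    unfolding hausdorff_distance_def by simp
qed

lemma hausdorff_distance_nonneg:
  assumes "mbounded A" "A \<noteq> {}" "mbounded B" "B \<noteq> {}"
  shows "0 \<le> hausdorff_distance d A B"
  using assms point_set_dist_nonneg point_set_dist_le_hausdorff_distance
  by (metis all_not_in_conv order_trans)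

text \<open>The infimum need not be attained, so a near point is only guaranteed for a radius
  strictly above the Hausdorff distance.\<close>

lemma hausdorff_distance_less_imp_ex_near:
  assumes "mbounded A" "mbounded B" "B \<noteq> {}" "a \<in> A" "hausdorff_distance d A B < r"
  shows "\<exists>b\<in>B. d a b < r"
proof -
  have "(INF b\<in>B. d a b) < r"
    using point_set_dist_le_hausdorff_distance[OF assms(1-4)] assms(5)
    by (simp add: point_set_dist_def)
  then show ?thesis
    using assms(3) by (subst (asm) cINF_less_iff) (auto intro: bdd_belowI2[of _ 0])
qed

subsection \<open>Chains and Cauchy sequences\<close>

lemma dist_chain_le_sum:
  assumes "\<And>i. i \<le> n \<Longrightarrow> x i \<in> M"
  shows "d (x 0) (x n) \<le> (\<Sum>i<n. d (x i) (x (Suc i)))"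
  using assms
proof (induction n)
  case (Suc n)
  have "d (x 0) (x (Suc n)) \<le> d (x 0) (x n) + d (x n) (x (Suc n))"
    using Suc.prems by (intro triangle) auto
  then show ?case using Suc by fastforce
qed simp

lemma MCauchy_geometric:
  assumes x: "range x \<subseteq> M" and q: "0 \<le> q" "q < 1"
    and step: "\<And>m. d (x m) (x (Suc m)) \<le> K * q ^ m"
  shows "MCauchy x"
proof -
  have K: "0 \<le> K"
    using order_trans[OF nonneg step[of 0]] by simp
  have le: "d (x m) (x n) \<le> K / (1 - q) * q ^ m" if "m \<le> n" for m n
  proof -
    \<comment> \<open>The partial geometric sum is kept exact so that the induction closes;
      \<open>q ^ n\<close> is dropped afterwards.\<close>
    have "d (x m) (x n) \<le> K / (1 - q) * (q ^ m - q ^ n)"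
      using that
    proof (induction n rule: dec_induct)
      case base
      have "x m \<in> M" using x by auto
      then show ?case by simp
    next
      case (step n)
      have "d (x m) (x (Suc n)) \<le> d (x m) (x n) + d (x n) (x (Suc n))"
        using x by (intro triangle) auto
      also have "\<dots> \<le> K / (1 - q) * (q ^ m - q ^ n) + K * q ^ n"
        using step.IH assms(4) by (intro add_mono)
      also have "\<dots> = K / (1 - q) * (q ^ m - q ^ Suc n)"
        using q by (simp add: field_simps)
      finally show ?case .
    qed
    also have "\<dots> \<le> K / (1 - q) * q ^ m"
      using K q by (intro mult_left_mono) auto
    finally show ?thesis .
  qed
  have lim: "(\<lambda>m. K / (1 - q) * q ^ m) \<longlonglongrightarrow> 0"
    using q by (intro tendsto_mult_right_zero LIMSEQ_realpow_zero)
  show ?thesis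
    unfolding MCauchy_def
  proof (intro conjI x allI impI)
    fix e :: real assume "0 < e"
    then obtain N where N: "\<And>m. N \<le> m \<Longrightarrow> K / (1 - q) * q ^ m < e"
      using order_tendstoD(2)[OF lim] unfolding eventually_sequentially by blast
    have "d (x m) (x n) < e" if "N \<le> m" "N \<le> n" for m n
      using le[of m n] le[of n m] N[OF that(1)] N[OF that(2)] commute[of "x m" "x n"]
      by (cases "m \<le> n") auto
    then show "\<exists>N. \<forall>m n. N \<le> m \<longrightarrow> N \<le> n \<longrightarrow> d (x m) (x n) < e"
      by blast
  qed
qed

lemma chainable_imp_ex_chain:
  assumes "chainable M d \<epsilon>" "a \<in> M" "b \<in> M"
  shows "\<exists>n y. (\<forall>i\<le>n. y i \<in> M) \<and> y 0 = a \<and> y n = b \<and> (\<forall>i<n. d (y i) (y (Suc i)) < \<epsilon>)"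
proof -
  obtain n and x :: "nat \<Rightarrow> 'a" where n: "n \<ge> 1" and x: "\<forall>i\<in>{1..n}. x i \<in> M" "x 1 = a" "x n = b"
    "\<forall>i. 1 \<le> i \<and> i \<le> n - 1 \<longrightarrow> d (x i) (x (i + 1)) < \<epsilon>"
    using bspec[OF bspec[OF assms(1)[unfolded chainable_def] assms(2)] assms(3)]
    by (elim exE conjE)
  \<comment> \<open>Points are renumbered from 0, so the new \<open>n\<close> counts links instead
    of points.\<close>
  show ?thesis
    by (intro exI[of _ "n - 1"] exI[of _ "\<lambda>i. x (Suc i)"]) (use n x in auto)
qed

text \<open>The set \<open>C\<close> of points reachable from \<open>a\<close> by links shorter than
  \<open>\<epsilon>\<close> is clopen: a ball of radius \<open>\<epsilon>\<close> lies in
  \<open>C\<close> if its centre does, and misses \<open>C\<close> otherwise.\<close>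

lemma connected_imp_chainable:
  assumes conn: "connected_space mtopology" and \<epsilon>: "0 < \<epsilon>"
  shows "chainable M d \<epsilon>"
  unfolding chainable_def
proof (intro ballI)
  fix a b assume a: "a \<in> M" and b: "b \<in> M"
  define R where "R = {(x, y). x \<in> M \<and> y \<in> M \<and> d x y < \<epsilon>}"
  define C where "C = {x \<in> M. (a, x) \<in> R\<^sup>*}"
  have near: "y \<in> C \<longleftrightarrow> x \<in> C" if "x \<in> M" "y \<in> M" "d x y < \<epsilon>" for x y
  proof -
    have "(x, y) \<in> R" "(y, x) \<in> R"
      using that by (auto simp: R_def commute)
    then show ?thesis
      unfolding C_def using that by (auto intro: rtrancl_into_rtrancl)
  qed
  have CM: "C \<subseteq> M"
    by (auto simp: C_def)
  have "openin mtopology C"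
    unfolding openin_mtopology
  proof (intro conjI CM allI impI exI[of _ \<epsilon>] \<epsilon>)
    show "mball x \<epsilon> \<subseteq> C" if "x \<in> C" for x
      using near[of x] that by auto
  qed
  moreover have "closedin mtopology C"
    unfolding closedin_metric
  proof (intro conjI CM allI impI exI[of _ \<epsilon>] \<epsilon>)
    show "disjnt C (mball x \<epsilon>)" if "x \<in> M - C" for x
      using near[of x] that by (auto simp: disjnt_iff)
  qed
  moreover have "a \<in> C"
    using a by (simp add: C_def)
  ultimately have "C = M"
    using conn unfolding connected_space_clopen_in by auto
  then obtain n where "(a, b) \<in> R ^^ n"
    using b by (auto simp: C_def dest: rtrancl_imp_relpow)
  then obtain g where g: "g 0 = a" "g n = b" "\<And>i. i < n \<Longrightarrow> (g i, g (Suc i)) \<in> R"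
    unfolding relpow_fun_conv by blast
  have gM: "g i \<in> M" if "i \<le> n" for i
  proof (cases "i < n")
    case True
    then show ?thesis using g(3)[of i] by (simp add: R_def)
  next
    case False
    then show ?thesis using that g(2) b by simp
  qed
  have "d (g (i - 1)) (g i) < \<epsilon>" if "1 \<le> i" "i \<le> n" for i
    using g(3)[of "i - 1"] that by (simp add: R_def)
  \<comment> \<open>A path of \<open>n\<close> links has \<open>Suc n\<close> points, here numbered
    from 1.\<close>
  then show "\<exists>n\<ge>1. \<exists>x :: nat \<Rightarrow> 'a. (\<forall>i\<in>{1..n}. x i \<in> M) \<and> x 1 = a \<and> x n = b \<and>
      (\<forall>i. 1 \<le> i \<and> i \<le> n - 1 \<longrightarrow> d (x i) (x (i + 1)) < \<epsilon>)"
    by (intro exI[of _ "Suc n"] conjI exI[of _ "\<lambda>i. g (i - 1)"]) (use g gM in auto)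
qed

subsection \<open>Local contractions\<close>

text \<open>Contraction is assumed only at positive distances, since the estimate derived from
  \<open>f\<close> holds only for \<open>t > 0\<close>.\<close>

lemma local_contraction_fixpoint:
  assumes ne: "M \<noteq> {}" and T: "T \<in> M \<rightarrow> CB M d"
    and \<epsilon>: "0 < \<epsilon>" and c: "0 < c" "c < 1"
    and contr: "\<And>x y. x \<in> M \<Longrightarrow> y \<in> M \<Longrightarrow> 0 < d x y \<Longrightarrow> d x y < \<epsilon> \<Longrightarrow>
      hausdorff_distance d (T x) (T y) \<le> c * d x y"
    and compl: "mcomplete" and chain: "chainable M d \<epsilon>"
  shows "\<exists>x\<in>M. x \<in> T x"
proof -
  have TCB: "T x \<noteq> {}" "closedin mtopology (T x)" "mbounded (T x)" "T x \<subseteq> M" if "x \<in> M" for x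
    using T that by (auto simp: CB_def dest: mbounded_subset_mspace)
  \<comment> \<open>The gap between \<open>c\<close> and \<open>q\<close> provides the strict
    inequality needed to select a near point.\<close>
  obtain q where q: "c < q" "q < 1"
    using dense[OF c(2)] by blast
  have q0: "0 < q"
    using c q by simp
  have lift: "\<exists>v\<in>T y. d u v \<le> q * d x y"
    if "x \<in> M" "y \<in> M" "d x y < \<epsilon>" "u \<in> T x" for x y u
  \<comment> \<open>At distance 0 no strict inequality is available, but \<open>u\<close> itself
    serves as \<open>v\<close>.\<close>
  proof (cases "x = y")
    case True
    moreover have "u \<in> M"
      using that TCB(4) by blast
    ultimately show ?thesis
      using that by (intro bexI[of _ u]) auto
  next
    case False
    then have pos: "0 < d x y"
      using that by simp
    then have "hausdorff_distance d (T x) (T y) < q * d x y"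
      using contr[OF that(1,2) pos that(3)] mult_strict_right_mono[OF q(1) pos] by linarith
    then show ?thesis
      using hausdorff_distance_less_imp_ex_near[of "T x" "T y" u] TCB that
      by (meson less_imp_le)
  qed
  obtain x0 where x0: "x0 \<in> M"
    using ne by blast
  obtain x1 where x1: "x1 \<in> T x0"
    using TCB(1)[OF x0] by blast
  obtain n y0 where y0: "\<forall>i\<le>n. y0 i \<in> M" "y0 0 = x0" "y0 n = x1"
    "\<forall>i<n. d (y0 i) (y0 (Suc i)) < \<epsilon>"
    using chainable_imp_ex_chain[OF chain x0] TCB(4)[OF x0] x1 by blast
  \<comment> \<open>The number \<open>n\<close> of links stays fixed. The bound
    \<open>\<epsilon>\<close> keeps every link within reach of \<open>lift\<close>; the bound
    \<open>\<epsilon> * q ^ m\<close> yields the Cauchy property.\<close>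
  define P where "P m y \<longleftrightarrow> (\<forall>i\<le>n. y i \<in> M) \<and> y n \<in> T (y 0) \<and>
      (\<forall>i<n. d (y i) (y (Suc i)) < \<epsilon> \<and> d (y i) (y (Suc i)) \<le> \<epsilon> * q ^ m)" for m y
  \<comment> \<open>Each chain starts where the previous one ends, so successive initial points
    satisfy \<open>x (Suc m) \<in> T (x m)\<close>.\<close>
  define Q where "Q y z \<longleftrightarrow> z 0 = y n" for y z :: "nat \<Rightarrow> 'a"
  have "\<exists>Y. \<forall>m. P m (Y m) \<and> Q (Y m) (Y (Suc m))"
  proof (rule dependent_nat_choice)
    show "\<exists>y. P 0 y"
      using y0 x1 by (intro exI[of _ y0]) (auto simp: P_def less_imp_le)
  next
    fix y m assume y: "P m y"
    \<comment> \<open>The new chain starts at \<open>y n\<close>, a point of \<open>T (y 0)\<close>,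
      and is extended link by link with \<open>lift\<close>. Beyond index \<open>n\<close> nothing
      is demanded.\<close>
    have "\<exists>z. \<forall>i. (i \<le> n \<longrightarrow> z i \<in> T (y i)) \<and> (i = 0 \<longrightarrow> z i = y n) \<and>
        (i < n \<longrightarrow> d (z i) (z (Suc i)) \<le> q * d (y i) (y (Suc i)))"
    proof -
      have "\<exists>z. \<forall>i. ((i \<le> n \<longrightarrow> z i \<in> T (y i)) \<and> (i = 0 \<longrightarrow> z i = y n)) \<and>
        (i < n \<longrightarrow> d (z i) (z (Suc i)) \<le> q * d (y i) (y (Suc i)))"
      proof (rule dependent_nat_choice)
        show "\<exists>u. (0 \<le> n \<longrightarrow> u \<in> T (y 0)) \<and> (0 = (0 :: nat) \<longrightarrow> u = y n)"
          using y by (auto simp: P_def)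
      next
        fix u and i :: nat
        assume u: "(i \<le> n \<longrightarrow> u \<in> T (y i)) \<and> (i = 0 \<longrightarrow> u = y n)"
        show "\<exists>v. ((Suc i \<le> n \<longrightarrow> v \<in> T (y (Suc i))) \<and> (Suc i = 0 \<longrightarrow> v = y n)) \<and>
            (i < n \<longrightarrow> d u v \<le> q * d (y i) (y (Suc i)))"
        proof (cases "i < n")
          case True
          then show ?thesis
            using lift[of "y i" "y (Suc i)" u] u y unfolding P_def by fastforce
        qed auto
      qed
      then show ?thesis by auto
    qed
    then obtain z where z: "\<And>i. i \<le> n \<Longrightarrow> z i \<in> T (y i)" "z 0 = y n"
      "\<And>i. i < n \<Longrightarrow> d (z i) (z (Suc i)) \<le> q * d (y i) (y (Suc i))"
      by blast
    have "P (Suc m) z"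
      unfolding P_def
    proof (intro conjI allI impI)
      show "z i \<in> M" if "i \<le> n" for i
        using z(1)[OF that] TCB(4)[of "y i"] y that by (auto simp: P_def)
      \<comment> \<open>The endpoint lies in \<open>T (y n)\<close>, and \<open>y n\<close> is the
        new starting point.\<close>
      show "z n \<in> T (z 0)"
        using z(1)[of n] z(2) by simp
      fix i assume i: "i < n"
      have yi: "d (y i) (y (Suc i)) < \<epsilon>" "d (y i) (y (Suc i)) \<le> \<epsilon> * q ^ m"
        using y i by (auto simp: P_def)
      have "q * d (y i) (y (Suc i)) \<le> 1 * d (y i) (y (Suc i))"
        using q by (intro mult_right_mono) auto
      then show "d (z i) (z (Suc i)) < \<epsilon>"
        using z(3)[OF i] yi(1) by linarith
      show "d (z i) (z (Suc i)) \<le> \<epsilon> * q ^ Suc m"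
        using order_trans[OF z(3)[OF i] mult_left_mono[OF yi(2)]] q0 by (simp add: mult.left_commute)
    qed
    then show "\<exists>z. P (Suc m) z \<and> Q y z"
      using z(2) by (auto simp: Q_def)
  qed
  then obtain Y where Y: "\<And>m. P m (Y m)" "\<And>m. Y (Suc m) 0 = Y m n"
    unfolding Q_def by blast
  define x where "x m = Y m 0" for m
  have xM: "x m \<in> M" for m
    using Y(1)[of m] by (simp add: P_def x_def)
  have xT: "x (Suc m) \<in> T (x m)" for m
    using Y(1)[of m] Y(2)[of m] by (simp add: P_def x_def)
  have "d (x m) (x (Suc m)) \<le> (real n * \<epsilon>) * q ^ m" for m
  proof -
    have "d (Y m 0) (Y m n) \<le> (\<Sum>i<n. d (Y m i) (Y m (Suc i)))"
      using Y(1)[of m] by (intro dist_chain_le_sum) (auto simp: P_def)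
    also have "\<dots> \<le> (\<Sum>i<n. \<epsilon> * q ^ m)"
      using Y(1)[of m] by (intro sum_mono) (auto simp: P_def)
    finally show ?thesis
      by (simp add: x_def Y(2) mult.assoc)
  qed
  then have "MCauchy x"
    using xM q q0 by (intro MCauchy_geometric[of x q]) auto
  then obtain p where p: "limitin mtopology x p sequentially"
    using compl unfolding mcomplete_def by blast
  have pM: "p \<in> M" and plim: "\<And>e. 0 < e \<Longrightarrow> \<exists>N. \<forall>m\<ge>N. d (x m) p < e"
    using p unfolding limit_metric_sequentially by blast+
  \<comment> \<open>Since \<open>x (Suc N) \<in> T (x N)\<close>, \<open>lift\<close> gives a point
    \<open>v\<close> of \<open>T p\<close> with \<open>d (x (Suc N)) v \<le> q * d (x N) p\<close>.
    Both this and \<open>d p (x (Suc N))\<close> are below \<open>r / 2\<close>; the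
    \<open>\<epsilon>\<close> in the minimum makes \<open>lift\<close> applicable.\<close>
  have "p \<in> mtopology closure_of (T p)"
    unfolding metric_closure_of
  proof (intro CollectI conjI pM allI impI)
    fix r :: real assume "0 < r"
    then have e: "0 < min \<epsilon> (r / 2)"
      using \<epsilon> by simp
    obtain N where N: "\<And>m. N \<le> m \<Longrightarrow> d (x m) p < min \<epsilon> (r / 2)"
      using plim[OF e] by blast
    obtain v where v: "v \<in> T p" "d (x (Suc N)) v \<le> q * d (x N) p"
      using lift[OF xM pM _ xT, of N] N[of N] by auto
    have vM: "v \<in> M"
      using v(1) TCB(4)[OF pM] by blast
    have "q * d (x N) p \<le> 1 * d (x N) p"
      using q by (intro mult_right_mono) auto
    then have "d p v < r"
      using triangle[OF pM xM vM, of "Suc N"] v(2) N[of N] N[of "Suc N"] commute[of p "x (Suc N)"]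
      by simp
    then show "\<exists>v\<in>T p. v \<in> mball p r"
      using v(1) vM pM by auto
  qed
  then have "p \<in> T p"
    using closure_of_closedin[OF TCB(2)[OF pM]] by simp
  then show ?thesis
    using pM by blast
qed

end

theorem theorem32:
  fixes f :: "real \<Rightarrow> real" and k :: real
  assumes f: "metric_preserving f"
    and k: "0 < k" "k < 1"
    and b: "(\<exists>L. has_right_deriv_0 f L \<and> ereal k < L) \<or>
            (\<exists>c. 0 < c \<and> c < 1 \<and> (\<forall>\<^sub>F t in at_right 0. k * t \<le> f (c * t)))"
  shows "\<exists>\<epsilon>\<^sub>0>0. \<forall>(X :: 'a set) d T.
           X \<noteq> {} \<and> Metric_space X d \<and> T \<in> X \<rightarrow> CB X d \<and>
           (\<forall>x\<in>X. \<forall>y\<in>X. f (hausdorff_distance d (T x) (T y)) \<le> k * d x y) \<longrightarrow>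
             (\<forall>\<epsilon>. 0 < \<epsilon> \<and> \<epsilon> < \<epsilon>\<^sub>0 \<longrightarrow>
                Metric_space.mcomplete X d \<and> chainable X d \<epsilon> \<longrightarrow> (\<exists>x\<in>X. x \<in> T x)) \<and>
             (Metric_space.mcomplete X d \<and> connected_space (Metric_space.mtopology X d) \<longrightarrow>
                (\<exists>x\<in>X. x \<in> T x))"
proof -
  have "f 0 = 0"
    using metric_preserving_isosceles(1)[OF f, of 1 1] by simp
  then obtain c where c: "0 < c" "c < 1" "\<forall>\<^sub>F t in at_right 0. k * t \<le> f (c * t)"
    using b right_deriv_gt_imp_eventually_le[OF _ _ _ k(1)] by blast
  \<comment> \<open>The threshold is obtained before any space or map is fixed, hence is uniform in
    them.\<close>
  obtain \<epsilon>0 where \<epsilon>0: "0 < \<epsilon>0"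
    "\<And>h t. 0 \<le> h \<Longrightarrow> 0 < t \<Longrightarrow> t < \<epsilon>0 \<Longrightarrow> f h \<le> k * t \<Longrightarrow> h \<le> c * t"
    using metric_preserving_le_imp_le[OF f k(1) c(1,3)] by blast
  have main: "\<exists>x\<in>X. x \<in> T x"
    if X: "X \<noteq> {}" "Metric_space X d" "T \<in> X \<rightarrow> CB X d"
      and H: "\<forall>x\<in>X. \<forall>y\<in>X. f (hausdorff_distance d (T x) (T y)) \<le> k * d x y"
      and \<epsilon>: "0 < \<epsilon>" "\<epsilon> < \<epsilon>0"
      and compl: "Metric_space.mcomplete X d" and chain: "chainable X d \<epsilon>"
    for X :: "'a set" and d T \<epsilon>
  proof -
    interpret Metric_space X d by (rule X(2))
    have TCB: "T x \<noteq> {}" "mbounded (T x)" if "x \<in> X" for x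
      using X(3) that by (auto simp: CB_def)
    have "hausdorff_distance d (T x) (T y) \<le> c * d x y"
      if "x \<in> X" "y \<in> X" "0 < d x y" "d x y < \<epsilon>" for x y
      using that \<epsilon> H by (intro \<epsilon>0(2) hausdorff_distance_nonneg TCB) auto
    then show ?thesis
      by (rule local_contraction_fixpoint[OF X(1,3) \<epsilon>(1) c(1,2) _ compl chain])
  qed
  show ?thesis
  proof (intro exI[of _ \<epsilon>0] conjI \<epsilon>0(1) allI impI)
    fix X :: "'a set" and d T \<epsilon>
    assume "X \<noteq> {} \<and> Metric_space X d \<and> T \<in> X \<rightarrow> CB X d \<and>
      (\<forall>x\<in>X. \<forall>y\<in>X. f (hausdorff_distance d (T x) (T y)) \<le> k * d x y)"
      and "0 < \<epsilon> \<and> \<epsilon> < \<epsilon>0" and "Metric_space.mcomplete X d \<and> chainable X d \<epsilon>"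
    then show "\<exists>x\<in>X. x \<in> T x"
      using main[of X d T \<epsilon>] by blast
  next
    fix X :: "'a set" and d T
    assume X: "X \<noteq> {} \<and> Metric_space X d \<and> T \<in> X \<rightarrow> CB X d \<and>
      (\<forall>x\<in>X. \<forall>y\<in>X. f (hausdorff_distance d (T x) (T y)) \<le> k * d x y)"
      and conn: "Metric_space.mcomplete X d \<and> connected_space (Metric_space.mtopology X d)"
    \<comment> \<open>A connected space is chainable at every scale; half of
      \<open>\<epsilon>0\<close> is strictly below the threshold.\<close>
    have "chainable X d (\<epsilon>0 / 2)"
      using X conn \<epsilon>0(1) by (intro Metric_space.connected_imp_chainable) auto
    then show "\<exists>x\<in>X. x \<in> T x"
      using main[of X d T "\<epsilon>0 / 2"] X conn \<epsilon>0(1) by auto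
  qed
qed

end
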